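(* Let $X$ be a finite set. The monoid $(\mathcal{M}(X), \triangleright)$ is isomorphic to the submonoid of $\mathcal{T}_{X\times X}$ consisting of all transformations $T : X\times X\to X\times X$ that commute with $^\leftarrow$, i.e. such that $T((a,b)^\leftarrow) = (T(a,b))^\leftarrow$ for all $a,b\in X$.
   Context: $\mathcal{M}(X)=X^{X\times X}$ is the set of all binary operations on $X$. The operation $\triangleright$ on $\mathcal{M}(X)$ is defined by $a(\circ\triangleright\ast)b=(a\circ b)\ast(b\circ a)$ for all $\circ,\ast\in\mathcal{M}(X)$ and $a,b\in X$; $(\mathcal{M}(X),\triangleright)$ is a monoid whose identity is the left zeros operation $a\circ_{lz}b=a$. $\mathcal{T}_{X\times X}$ is the monoid of all maps $X\times X\to X\times X$, with product given by composition from left to right: the product $ST$ is the map $p\mapsto T(S(p))$. For $u,v\in X$, $(u,v)^\leftarrow=(v,u)$. *)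

theory Defs
  imports "HOL-Algebra.Group"
begin

text \<open>Maps on a set are extensional functions (\<open>\<rightarrow>\<^sub>E\<close>), so that equality
  of maps is equality on their domain. A binary operation \<open>f\<close> on \<open>X\<close> is a map
  \<open>X \<times> X \<rightarrow> X\<close>, and \<open>f (a, b)\<close> is the product of \<open>a\<close> and \<open>b\<close>.\<close>

definition binops :: "'a set \<Rightarrow> ('a \<times> 'a \<Rightarrow> 'a) set"
  where "binops X = X \<times> X \<rightarrow>\<^sub>E X"

definition tri :: "'a set \<Rightarrow> ('a \<times> 'a \<Rightarrow> 'a) \<Rightarrow> ('a \<times> 'a \<Rightarrow> 'a) \<Rightarrow> ('a \<times> 'a \<Rightarrow> 'a)"
  where "tri X f g = (\<lambda>(a, b) \<in> X \<times> X. g (f (a, b), f (b, a)))"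

definition left_zeros :: "'a set \<Rightarrow> 'a \<times> 'a \<Rightarrow> 'a"
  where "left_zeros X = (\<lambda>(a, b) \<in> X \<times> X. a)"

definition binop_monoid :: "'a set \<Rightarrow> ('a \<times> 'a \<Rightarrow> 'a) monoid"
  where "binop_monoid X = \<lparr>carrier = binops X, mult = tri X, one = left_zeros X\<rparr>"

text \<open>Transformations are multiplied from left to right, whereas
  \<open>compose S g f\<close> applies \<open>f\<close> first.\<close>

definition transf_monoid :: "'s set \<Rightarrow> ('s \<Rightarrow> 's) monoid"
  where "transf_monoid S =
    \<lparr>carrier = S \<rightarrow>\<^sub>E S, mult = (\<lambda>f g. compose S g f), one = (\<lambda>x \<in> S. x)\<rparr>"

definition swap_commuting :: "'a set \<Rightarrow> ('a \<times> 'a \<Rightarrow> 'a \<times> 'a) set"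
  where "swap_commuting X =
    {T \<in> carrier (transf_monoid (X \<times> X)).
      \<forall>a \<in> X. \<forall>b \<in> X. T (prod.swap (a, b)) = prod.swap (T (a, b))}"

lemma monoid_binop_monoid: "monoid (binop_monoid X)"
proof -
  have closed: "f (a, b) \<in> X" if "f \<in> binops X" "a \<in> X" "b \<in> X" for f a b
    using that unfolding binops_def by blast
  have outside: "f p = undefined" if "f \<in> binops X" "p \<notin> X \<times> X" for f p
    using that PiE_arb unfolding binops_def by metis
  have tri_closed: "tri X f g \<in> binops X" if "f \<in> binops X" "g \<in> binops X" for f g
  proof -
    have "tri X f g (a, b) \<in> X" if "a \<in> X" "b \<in> X" for a b
      using that by (simp add: tri_def closed \<open>f \<in> binops X\<close> \<open>g \<in> binops X\<close>)
    moreover have "tri X f g p = undefined" if "p \<notin> X \<times> X" for p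
      using that unfolding tri_def by (simp only: restrict_apply if_False)
    ultimately show ?thesis
      unfolding binops_def by (intro PiE_I) blast+
  qed
  have one_closed: "left_zeros X \<in> binops X"
    by (simp add: binops_def left_zeros_def split_beta mem_Times_iff)
  have assoc: "tri X (tri X f g) h = tri X f (tri X g h)" if "f \<in> binops X" for f g h
  proof (rule ext)
    fix p :: "'a \<times> 'a"
    show "tri X (tri X f g) h p = tri X f (tri X g h) p"
      by (cases p) (simp add: tri_def closed[OF that])
  qed
  have l_one: "tri X (left_zeros X) f = f" if "f \<in> binops X" for f
  proof (rule ext)
    fix p :: "'a \<times> 'a"
    show "tri X (left_zeros X) f p = f p"
      by (cases p) (simp add: tri_def left_zeros_def outside[OF that])
  qed
  have r_one: "tri X f (left_zeros X) = f" if "f \<in> binops X" for f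
  proof (rule ext)
    fix p :: "'a \<times> 'a"
    show "tri X f (left_zeros X) p = f p"
      by (cases p) (simp add: tri_def left_zeros_def outside[OF that] closed[OF that])
  qed
  show ?thesis
    by (rule monoidI) (simp_all add: binop_monoid_def tri_closed one_closed assoc l_one r_one)
qed

lemma monoid_transf_monoid: "monoid (transf_monoid S)"
proof -
  have closed: "compose S g f \<in> S \<rightarrow>\<^sub>E S" if "f \<in> S \<rightarrow>\<^sub>E S" "g \<in> S \<rightarrow>\<^sub>E S" for f g
    unfolding compose_def by (rule restrict_PiE_iff[THEN iffD2]) (use that in blast)
  have one_closed: "(\<lambda>x \<in> S. x) \<in> S \<rightarrow>\<^sub>E S"
    by (rule restrict_PiE_iff[THEN iffD2]) blast
  have assoc: "compose S h (compose S g f) = compose S (compose S h g) f"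
    if "f \<in> S \<rightarrow>\<^sub>E S" for f :: "'a \<Rightarrow> 'a" and g h :: "'a \<Rightarrow> 'a"
    by (rule compose_assoc) (use that in blast)
  have r_one: "compose S (\<lambda>x \<in> S. x) f = f" if "f \<in> S \<rightarrow>\<^sub>E S" for f
    by (rule Id_compose) (use that in \<open>auto simp: PiE_def\<close>)
  have l_one: "compose S f (\<lambda>x \<in> S. x) = f" if "f \<in> S \<rightarrow>\<^sub>E S" for f
    by (rule compose_Id) (use that in \<open>auto simp: PiE_def\<close>)
  show ?thesis
    by (rule monoidI) (simp_all add: transf_monoid_def closed one_closed assoc l_one r_one)
qed

end

theory Submission
  imports Defs
begin

text \<open>An operation \<open>f\<close> is sent to the transformation \<open>(a, b) \<mapsto> (f (a, b), f (b, a))\<close>. A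
  transformation commuting with the swap has this form, since its second component at \<open>(a, b)\<close>
  is its first component at \<open>(b, a)\<close>, so taking first components inverts the map.\<close>

definition transf_of_binop :: "'a set \<Rightarrow> ('a \<times> 'a \<Rightarrow> 'a) \<Rightarrow> 'a \<times> 'a \<Rightarrow> 'a \<times> 'a"
  where "transf_of_binop X f = (\<lambda>(a, b) \<in> X \<times> X. (f (a, b), f (b, a)))"

lemma binops_closed: "f \<in> binops X \<Longrightarrow> a \<in> X \<Longrightarrow> b \<in> X \<Longrightarrow> f (a, b) \<in> X"
  unfolding binops_def by blast

lemma transf_monoid_simps:
  "carrier (transf_monoid S) = S \<rightarrow>\<^sub>E S"
  "mult (transf_monoid S) f g = compose S g f"
  "one (transf_monoid S) = (\<lambda>x \<in> S. x)"
  by (simp_all add: transf_monoid_def)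

text \<open>Reduces membership to checks at points. The default value outside
  \<open>X \<times> X\<close> is one of them, because equality of maps there rests on
  extensionality.\<close>

lemma swap_commutingI:
  assumes "\<And>a b. a \<in> X \<Longrightarrow> b \<in> X \<Longrightarrow> T (a, b) \<in> X \<times> X"
    and "\<And>p. p \<notin> X \<times> X \<Longrightarrow> T p = undefined"
    and "\<And>a b. a \<in> X \<Longrightarrow> b \<in> X \<Longrightarrow> T (b, a) = prod.swap (T (a, b))"
  shows "T \<in> swap_commuting X"
proof -
  have "T \<in> X \<times> X \<rightarrow>\<^sub>E X \<times> X"
    using assms(1,2) by (intro PiE_I) blast+
  then show ?thesis
    using assms(3) unfolding swap_commuting_def transf_monoid_simps swap_simp by blast
qed

lemma swap_commutingD:
  assumes "T \<in> swap_commuting X"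
  shows "a \<in> X \<Longrightarrow> b \<in> X \<Longrightarrow> T (a, b) \<in> X \<times> X"
    and "p \<notin> X \<times> X \<Longrightarrow> T p = undefined"
    and "a \<in> X \<Longrightarrow> b \<in> X \<Longrightarrow> T (b, a) = prod.swap (T (a, b))"
proof -
  have T: "T \<in> X \<times> X \<rightarrow>\<^sub>E X \<times> X"
    using assms unfolding swap_commuting_def transf_monoid_simps by blast
  show "T (a, b) \<in> X \<times> X" if "a \<in> X" "b \<in> X"
    using T that by blast
  show "T p = undefined" if "p \<notin> X \<times> X"
    using T that by (rule PiE_arb)
  show "T (b, a) = prod.swap (T (a, b))" if "a \<in> X" "b \<in> X"
    using assms that unfolding swap_commuting_def swap_simp by blast
qed

text \<open>Commuting with a fixed map survives composition: the swap passes first through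
  \<open>S\<close> and then through \<open>T\<close>.\<close>

lemma submonoid_swap_commuting: "submonoid (swap_commuting X) (transf_monoid (X \<times> X))"
proof
  show "swap_commuting X \<subseteq> carrier (transf_monoid (X \<times> X))"
    by (auto simp: swap_commuting_def)
  show "\<one>\<^bsub>transf_monoid (X \<times> X)\<^esub> \<in> swap_commuting X"
    by (rule swap_commutingI) (auto simp: transf_monoid_simps)
  show "S \<otimes>\<^bsub>transf_monoid (X \<times> X)\<^esub> T \<in> swap_commuting X"
    if S: "S \<in> swap_commuting X" and T: "T \<in> swap_commuting X" for S T
  proof (rule swap_commutingI)
    fix a b assume ab: "a \<in> X" "b \<in> X"
    \<comment> \<open>The hypothesis on \<open>T\<close> speaks of explicit pairs, so the
      intermediate point is split into components; it lies in \<open>X \<times> X\<close>, where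
      \<open>T\<close> commutes with the swap.\<close>
    obtain c d where cd: "S (a, b) = (c, d)" by fastforce
    then have cdX: "c \<in> X" "d \<in> X"
      using swap_commutingD(1)[OF S ab] by simp_all
    then show "(S \<otimes>\<^bsub>transf_monoid (X \<times> X)\<^esub> T) (a, b) \<in> X \<times> X"
      and "(S \<otimes>\<^bsub>transf_monoid (X \<times> X)\<^esub> T) (b, a)
        = prod.swap ((S \<otimes>\<^bsub>transf_monoid (X \<times> X)\<^esub> T) (a, b))"
      using ab cd swap_commutingD(1)[OF T cdX] swap_commutingD(3)[OF T cdX] swap_commutingD(3)[OF S ab]
      by (simp_all add: transf_monoid_simps compose_def)
  qed (simp add: transf_monoid_simps compose_def del: mem_Sigma_iff)
qed

lemma transf_of_binop_swap_commuting:
  assumes "f \<in> binops X"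
  shows "transf_of_binop X f \<in> swap_commuting X"
  by (rule swap_commutingI)
    (auto simp: transf_of_binop_def binops_closed[OF assms])

text \<open>Exchanging \<open>a\<close> and \<open>b\<close> exchanges the two arguments that
  \<open>g\<close> receives, so both sides send \<open>(a, b)\<close> to the values of
  \<open>g\<close> at \<open>(f (a, b), f (b, a))\<close> and at the swapped pair. Closure of
  \<open>f\<close> keeps this pair in \<open>X \<times> X\<close>, away from the default
  value.\<close>

lemma transf_of_binop_tri:
  assumes "f \<in> binops X"
  shows "transf_of_binop X (tri X f g) = compose (X \<times> X) (transf_of_binop X g) (transf_of_binop X f)"
  by (rule ext)
    (auto simp: transf_of_binop_def tri_def compose_def restrict_def binops_closed[OF assms])

lemma bij_betw_transf_of_binop: "bij_betw (transf_of_binop X) (binops X) (swap_commuting X)"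
proof (rule bij_betw_byWitness)
  \<comment> \<open>The restriction matters: outside \<open>X \<times> X\<close> the bare projection
    would give \<open>fst undefined\<close> instead of \<open>undefined\<close>.\<close>
  let ?g = "\<lambda>T. \<lambda>p \<in> X \<times> X. fst (T p)"
  show "\<forall>f \<in> binops X. ?g (transf_of_binop X f) = f"
    by (auto simp: transf_of_binop_def binops_def PiE_def extensional_def restrict_def fun_eq_iff)
  show "\<forall>T \<in> swap_commuting X. transf_of_binop X (?g T) = T"
  proof (intro ballI ext)
    fix T p assume T: "T \<in> swap_commuting X"
    show "transf_of_binop X (?g T) p = T p"
    proof (cases "p \<in> X \<times> X")
      case True
      then obtain a b where p: "p = (a, b)" and ab: "a \<in> X" "b \<in> X" by blast
      \<comment> \<open>The rebuilt second component is \<open>fst (T (b, a))\<close>, which is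
        \<open>snd (T (a, b))\<close> by commutation with the swap.\<close>
      then show ?thesis
        using swap_commutingD(3)[OF T ab] by (simp add: transf_of_binop_def)
    next
      case False
      then show ?thesis
        using swap_commutingD(2)[OF T] by (simp add: transf_of_binop_def del: mem_Sigma_iff)
    qed
  qed
  show "transf_of_binop X ` binops X \<subseteq> swap_commuting X"
    using transf_of_binop_swap_commuting by blast
  show "?g ` swap_commuting X \<subseteq> binops X"
    using swap_commutingD(1) by (fastforce simp: binops_def mem_Times_iff)
qed

theorem theorem3:
  fixes X :: "'a set"
  assumes "finite X"
  shows "submonoid (swap_commuting X) (transf_monoid (X \<times> X)) \<and>
    binop_monoid X \<cong> (transf_monoid (X \<times> X))\<lparr>carrier := swap_commuting X\<rparr>"
proof
  show "submonoid (swap_commuting X) (transf_monoid (X \<times> X))"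
    by (rule submonoid_swap_commuting)
  \<comment> \<open>Membership in \<open>iso\<close> asks for products and bijectivity only; a
    multiplicative bijection between monoids preserves the identity.\<close>
  have "transf_of_binop X \<in> iso (binop_monoid X)
      ((transf_monoid (X \<times> X))\<lparr>carrier := swap_commuting X\<rparr>)"
    by (auto simp: iso_def hom_def binop_monoid_def transf_monoid_simps
        transf_of_binop_swap_commuting transf_of_binop_tri bij_betw_transf_of_binop)
  then show "binop_monoid X \<cong> (transf_monoid (X \<times> X))\<lparr>carrier := swap_commuting X\<rparr>"
    by (rule is_isoI)
qed

end
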